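(* Let $m$ be a positive integer, $q=2^m$, let $G$ be the additive group of the finite field $\mathbb{F}_q$, and let $$D=\{z\in \mathbb{F}_q : z\neq 0 \text{ and } {\rm Tr}(z)={\rm Tr}(z^{-1})=1\}.$$ Then the Cayley graph $\mathfrak{C}(G,D)$ is a bipartite graph; its valency is $(2^m+1+k_m(1))/4$, the number $-(2^m+1+k_m(1))/4$ is also an eigenvalue, and all other eigenvalues are $(-k_m(a)+k_m(a+1))/4$ with $a\in\mathbb{F}_q$, $a\neq 0,1$. If $k_m(1)>3$, then $\mathfrak{C}(G,D)$ is a Ramanujan graph.
   Context: ${\rm Tr}:\mathbb{F}_{2^m}\to\mathbb{F}_2$ is the trace map. For $a\in\mathbb{F}_{2^m}$, the Kloosterman sum is $k_m(a)=\sum_{x\in\mathbb{F}_{2^m}^*}(-1)^{{\rm Tr}(ax+x^{-1})}$. The Cayley graph $\mathfrak{C}(G,D)$ has vertex set $\mathbb{F}_q$, and two vertices $u,v$ are adjacent if and only if $u-v\in D$. The eigenvalues of a graph are the eigenvalues of its adjacency matrix. A connected $k$-regular graph is called a Ramanujan graph if $\lambda\leq 2\sqrt{k-1}$ for all eigenvalues $\lambda$ of the graph with $|\lambda|\neq k$ (the first inequality is on $\lambda$ itself, as in the paper's definition). *)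

theory Defs
  imports "HOL-Analysis.Analysis" "Graph_Theory.Graph_Theory"
begin

section \<open>Trace and Kloosterman sums over fields of order \<open>2 ^ m\<close>\<close>

text \<open>
  The absolute trace of the field of order \<open>2 ^ m\<close>, given by the Frobenius conjugates.
  Its value is kept in the big field, where the prime field is \<open>{0, 1}\<close>;
  see \<open>abs_trace_in_prime_field\<close> below.
\<close>
definition abs_trace :: "nat \<Rightarrow> 'a::{field,finite} \<Rightarrow> 'a" where
  "abs_trace m x = (\<Sum>i<m. x ^ (2 ^ i))"

lemma power_card_field: "x ^ CARD('a) = (x :: 'a::{field,finite})"
proof (cases "x = 0")
  case False
  let ?U = "UNIV - {0 :: 'a}"
  have "bij_betw ((*) x) ?U ?U"
    using False by (intro bij_betwI[where g = "\<lambda>y. y / x"]) auto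
  then have "(\<Prod>y\<in>?U. x * y) = \<Prod>?U"
    by (rule prod.reindex_bij_betw)
  then have "x ^ card ?U * \<Prod>?U = \<Prod>?U"
    by (simp add: prod.distrib)
  moreover have "\<Prod>?U \<noteq> 0"
    by simp
  ultimately have "x ^ card ?U = 1"
    by simp
  moreover have "CARD('a) = Suc (card ?U)"
    using card_Suc_Diff1[of UNIV "0 :: 'a"] by simp
  ultimately show ?thesis
    by (simp only: power_Suc mult_1_right)
qed simp

lemma two_eq_0_field:
  assumes "CARD('a::{field,finite}) = 2 ^ m"
  shows "(2 :: 'a) = 0"
proof -
  have "bij_betw (\<lambda>y::'a. y + 1) UNIV UNIV"
    by (intro bij_betwI[where g = "\<lambda>y. y - 1"]) auto
  then have "(\<Sum>y\<in>UNIV. y + (1 :: 'a)) = \<Sum>UNIV"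
    by (rule sum.reindex_bij_betw)
  then have "of_nat (CARD('a)) = (0 :: 'a)"
    by (simp add: sum.distrib)
  then have "(2 :: 'a) ^ m = 0"
    by (simp add: assms)
  then show ?thesis
    by simp
qed

lemma abs_trace_in_prime_field:
  assumes "CARD('a::{field,finite}) = 2 ^ m"
  shows "abs_trace m (x :: 'a) \<in> {0, 1}"
proof -
  have two: "(2 :: 'a) = 0"
    using assms by (rule two_eq_0_field)
  have add_sq: "(a + b) ^ 2 = a ^ 2 + b ^ 2" for a b :: 'a
    by (simp add: power2_sum two)
  have "(\<Sum>i<n. x ^ (2 ^ i)) ^ 2 = (\<Sum>i<n. x ^ (2 ^ Suc i))" for n
  proof (induction n)
    case (Suc n)
    have "(x ^ (2 ^ n)) ^ 2 = x ^ (2 ^ Suc n)"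
      by (simp only: power_mult[symmetric] power_Suc mult.commute)
    then show ?case
      by (simp only: sum.lessThan_Suc add_sq Suc.IH)
  qed simp
  then have "abs_trace m x ^ 2 = (\<Sum>i<m. x ^ (2 ^ Suc i))"
    by (simp add: abs_trace_def)
  moreover have "x + (\<Sum>i<m. x ^ (2 ^ Suc i)) = abs_trace m x + x ^ (2 ^ m)"
    using sum.lessThan_Suc_shift[of "\<lambda>i. x ^ (2 ^ i)" m] by (simp add: abs_trace_def)
  moreover have "x ^ (2 ^ m) = x"
    using power_card_field[of x] assms by simp
  ultimately have "abs_trace m x * (abs_trace m x - 1) = 0"
    by (simp add: power2_eq_square algebra_simps)
  then show ?thesis
    by auto
qed

text \<open>\<open>(-1) ^ Tr x\<close>, with the exponent in the field with two elements.\<close>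
definition trace_sign :: "nat \<Rightarrow> 'a::{field,finite} \<Rightarrow> int" where
  "trace_sign m x = (if abs_trace m x = 0 then 1 else - 1)"

definition kloosterman :: "nat \<Rightarrow> 'a::{field,finite} \<Rightarrow> int" where
  "kloosterman m a = (\<Sum>x\<in>UNIV - {0}. trace_sign m (a * x + inverse x))"


section \<open>Graphs\<close>

text \<open>
  An undirected simple graph is a finite digraph without parallel arcs that is symmetric and
  loop-free (\<open>pair_graph\<close>); each undirected edge is a pair of opposite arcs, so
  the degree of a vertex is its out-degree.
\<close>

definition cayley_graph :: "'a::ab_group_add set \<Rightarrow> 'a pair_pre_digraph" where
  "cayley_graph D = \<lparr>pverts = UNIV, parcs = {(u, v). u - v \<in> D}\<rparr>"

definition bipartite_graph :: "'v pair_pre_digraph \<Rightarrow> bool" where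
  "bipartite_graph G \<longleftrightarrow> pair_graph G \<and>
     (\<exists>X Y. X \<union> Y = pverts G \<and> X \<inter> Y = {} \<and>
        (\<forall>(u, v) \<in> parcs G. (u \<in> X \<and> v \<in> Y) \<or> (u \<in> Y \<and> v \<in> X)))"

definition regular_graph :: "nat \<Rightarrow> 'v pair_pre_digraph \<Rightarrow> bool" where
  "regular_graph k G \<longleftrightarrow> pair_graph G \<and> (\<forall>v\<in>pverts G. out_degree (with_proj G) v = k)"

text \<open>
  The matrix is indexed by the whole type, so this is the adjacency matrix only of graphs whose
  vertex set is \<open>UNIV\<close>.
\<close>
definition adjacency_matrix :: "'v::finite pair_pre_digraph \<Rightarrow> real^'v^'v" where
  "adjacency_matrix G = (\<chi> u v. if (u, v) \<in> parcs G then 1 else 0)"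

text \<open>The adjacency matrix of a graph is real symmetric, so real eigenvalues are all there are.\<close>
definition matrix_eigenvalue :: "real^'n^'n \<Rightarrow> real \<Rightarrow> bool" where
  "matrix_eigenvalue A l \<longleftrightarrow> (\<exists>x. x \<noteq> 0 \<and> A *v x = l *s x)"

definition graph_eigenvalues :: "'v::finite pair_pre_digraph \<Rightarrow> real set" where
  "graph_eigenvalues G = {l. matrix_eigenvalue (adjacency_matrix G) l}"

text \<open>
  The bound is one-sided: it is imposed on \<open>l\<close>, not on its absolute value.
  The qualified name selects graph connectedness, not the topological notion.
\<close>
definition ramanujan_graph :: "'v::finite pair_pre_digraph \<Rightarrow> bool" where
  "ramanujan_graph G \<longleftrightarrow> pverts G = UNIV \<and> Digraph_Component.connected (with_proj G) \<and>
     (\<exists>k. regular_graph k G \<and>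
        (\<forall>l\<in>graph_eigenvalues G. \<bar>l\<bar> \<noteq> real k \<longrightarrow> l \<le> 2 * sqrt (real k - 1)))"

end

theory Submission
  imports Defs "HOL-Computational_Algebra.Polynomial"
begin

text \<open>
  The additive characters diagonalise the Cayley graph, and writing the indicator of \<open>D\<close> as
  \<open>(1 - \<chi> z) (1 - \<chi> (1 / z)) / 4\<close> expresses the eigenvalues by Kloosterman sums. The Ramanujan
  bound and connectedness need the Weil bound, used in the form \<open>k(a)\<^sup>2 \<le> 4 q + 1\<close>.

  The Weil bound follows Manin's proof of the Hasse inequality. With \<open>a = b\<^sup>2\<close>, the points
  \<open>P\<^sub>n = P\<^sub>0 + n Q\<close> of the twisted curve \<open>y\<^sup>2 + y = b (x + 1 / x + T + 1 / T)\<close> over \<open>F\<^sub>q(T)\<close>, where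
  \<open>P\<^sub>0\<close> is the Frobenius point and \<open>Q = (T, 0)\<close>, have first coordinates that form a chain
  of Vieta jumps. Their heights satisfy \<open>h\<^sub>n\<^sub>+\<^sub>1 + h\<^sub>n\<^sub>-\<^sub>1 = 2 h\<^sub>n + 2\<close>, so with the initial values
  \<open>h\<^sub>0 = q\<close> and \<open>h\<^sub>1 = q + 1 - k(a)\<close> we get \<open>h\<^sub>n = n\<^sup>2 - k(a) n + q\<close>. This is nonnegative for
  every integer \<open>n\<close>, which bounds the discriminant.
\<close>

section \<open>Comaximal polynomials and heights of rational functions\<close>


text \<open>
  The coprimality theory of the library needs a gcd, which \<open>'a poly\<close> lacks for a general
  field \<open>'a\<close>; hence coprimality is used in the form of a Bezout identity.
\<close>
definition comaximal :: "'a::comm_ring_1 \<Rightarrow> 'a \<Rightarrow> bool" where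
  "comaximal a b \<longleftrightarrow> (\<exists>u v. u * a + v * b = 1)"

lemma comaximal_commute: "comaximal a b \<longleftrightarrow> comaximal b a"
  unfolding comaximal_def by (subst ex_comm) (simp add: add.commute)

lemma comaximal_mult:
  assumes "comaximal a b" "comaximal a c"
  shows "comaximal a (b * c)"
proof -
  obtain u v u' v' where 1: "u * a + v * b = 1" and 2: "u' * a + v' * c = 1"
    using assms unfolding comaximal_def by blast
  have "(u * u' * a + u * v' * c + u' * v * b) * a + (v * v') * (b * c)
      = (u * a + v * b) * (u' * a + v' * c)"
    by (simp add: algebra_simps)
  then show ?thesis
    unfolding comaximal_def 1 2 by auto
qed

lemma comaximal_1: "comaximal a 1"
  unfolding comaximal_def by (rule exI[of _ 0], rule exI[of _ 1]) simp

lemma comaximal_power: "comaximal a b \<Longrightarrow> comaximal a (b ^ n)"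
  by (induction n) (auto simp: comaximal_1 comaximal_mult)

lemma comaximal_power_power: "comaximal a b \<Longrightarrow> comaximal (a ^ n) (b ^ k)"
  using comaximal_power[of "b ^ k" a n] comaximal_power[of a b k]
  by (simp add: comaximal_commute[of _ "b ^ k"])

lemma comaximal_prod:
  assumes "\<And>i. i \<in> I \<Longrightarrow> comaximal a (f i)"
  shows "comaximal a (prod f I)"
  using assms by (induction I rule: infinite_finite_induct) (auto simp: comaximal_1 comaximal_mult)

lemma comaximal_dvd_cancel:
  assumes "comaximal a c" "a dvd c * x"
  shows "a dvd x"
proof -
  obtain u v where 1: "u * a + v * c = 1"
    using assms(1) unfolding comaximal_def by blast
  have "x = (u * a + v * c) * x"
    by (simp add: 1)
  also have "\<dots> = a * (u * x) + v * (c * x)"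
    by (simp add: algebra_simps)
  finally show ?thesis
    using assms(2) by (metis dvd_add dvd_mult dvd_triv_left)
qed

lemma comaximal_dvd_1: "comaximal a b \<Longrightarrow> c dvd a \<Longrightarrow> c dvd b \<Longrightarrow> c dvd 1"
  unfolding comaximal_def by (elim exE) (erule subst, intro dvd_add dvd_mult)

text \<open>Modulo \<open>[:- a, 1:]\<close> the polynomial \<open>p\<close> is the constant
  \<open>poly p a\<close>, which is invertible.\<close>

lemma comaximal_linear_poly:
  fixes p :: "'a::field poly"
  assumes "poly p a \<noteq> 0"
  shows "comaximal p [:- a, 1:]"
proof -
  have "[:- a, 1:] dvd p - [:poly p a:]"
    by (simp add: poly_eq_0_iff_dvd[symmetric])
  then obtain k where k: "p - [:poly p a:] = [:- a, 1:] * k"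
    by (elim dvdE)
  have "[:1 / poly p a:] * p + (- [:1 / poly p a:] * k) * [:- a, 1:]
      = [:1 / poly p a:] * (p - [:- a, 1:] * k)"
    by (simp only: right_diff_distrib mult_minus_left mult.assoc mult.left_commute[of k] mult.commute[of k]) (simp only: diff_conv_add_uminus)
  also have "p - [:- a, 1:] * k = [:poly p a:]"
    unfolding k[symmetric] by simp
  finally show ?thesis
    unfolding comaximal_def using assms
    by (intro exI[of _ "[:1 / poly p a:]"] exI[of _ "- [:1 / poly p a:] * k"]) (simp add: one_pCons)
qed

text \<open>A nonzero element of least degree in the ideal generated by \<open>p\<close> and
  \<open>q\<close> divides both by division with remainder, so it is a unit.\<close>

lemma comaximal_polyI:
  fixes p q :: "'a::field poly"
  assumes nz: "p \<noteq> 0 \<or> q \<noteq> 0"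
    and unit: "\<And>g. g dvd p \<Longrightarrow> g dvd q \<Longrightarrow> g dvd 1"
  shows "comaximal p q"
proof -
  define I where "I = {u * p + v * q | u v. True}"
  have pI: "p \<in> I" and qI: "q \<in> I"
    unfolding I_def by (force intro: exI[of _ 0] exI[of _ 1])+
  obtain g where g: "g \<in> I" "g \<noteq> 0" and min: "\<And>h. h \<in> I \<Longrightarrow> h \<noteq> 0 \<Longrightarrow> degree g \<le> degree h"
    using nz pI qI ex_has_least_nat[of "\<lambda>g. g \<in> I \<and> g \<noteq> 0" _ degree] by metis
  have dvd: "g dvd h" if "h \<in> I" for h
  proof -
    from g(1) obtain u v where "g = u * p + v * q" unfolding I_def by blast
    moreover from that obtain u' v' where "h = u' * p + v' * q" unfolding I_def by blast
    ultimately have "h - (h div g) * g = (u' - h div g * u) * p + (v' - h div g * v) * q"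
      by (simp add: algebra_simps)
    moreover have "h mod g = h - (h div g) * g"
      by (simp add: minus_div_mult_eq_mod)
    ultimately have "h mod g \<in> I"
      unfolding I_def by (metis (mono_tags, lifting) mem_Collect_eq)
    then have "h mod g = 0"
      using min[of "h mod g"] degree_mod_less[OF g(2), of h] by fastforce
    then show ?thesis
      by auto
  qed
  have "g dvd 1"
    using unit dvd pI qI by blast
  then obtain k where k: "1 = g * k"
    by (elim dvdE)
  from g(1) obtain u v where "g = u * p + v * q" unfolding I_def by blast
  then have "(k * u) * p + (k * v) * q = 1"
    using k by (simp add: algebra_simps)
  then show ?thesis
    unfolding comaximal_def by blast
qed

section \<open>Heights of rational functions\<close>

lemma coeff_mult_bound:
  fixes p q :: "'a::comm_ring_1 poly"
  assumes "degree p \<le> m" "degree q \<le> n"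
  shows "coeff (p * q) (m + n) = coeff p m * coeff q n"
proof (cases "degree p = m \<and> degree q = n")
  case True
  then show ?thesis
    using coeff_mult_degree_sum[of p q] by auto
next
  case False
  then have "degree p < m \<or> degree q < n"
    using assms by auto
  moreover from this have "degree (p * q) < m + n"
    using degree_mult_le[of p q] assms by linarith
  ultimately show ?thesis
    by (auto simp: coeff_eq_0)
qed

text \<open>For comaximal \<open>p\<close>, \<open>q\<close> over a field this is the degree of
  \<open>p / q\<close> as a map of the projective line.\<close>

definition ratio_height :: "'a::zero poly \<Rightarrow> 'a poly \<Rightarrow> nat" where
  "ratio_height p q = max (degree p) (degree q)"

lemma ratio_height_coeff:
  "p \<noteq> 0 \<or> q \<noteq> 0 \<Longrightarrow>
    coeff p (ratio_height p q) \<noteq> 0 \<or> coeff q (ratio_height p q) \<noteq> 0"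
  unfolding ratio_height_def
  using leading_coeff_neq_0[of p] leading_coeff_neq_0[of q]
  by (cases "degree p \<le> degree q"; cases "p = 0"; cases "q = 0") (auto simp: max_def)

lemma ratio_height_bounds: "degree p \<le> ratio_height p q" "degree q \<le> ratio_height p q"
  unfolding ratio_height_def by auto

section \<open>The chain of Vieta jumps and its heights\<close>

abbreviation T :: "'a::field poly" where "T \<equiv> [:0, 1:]"

text \<open>
  With \<open>x = p / q\<close> and \<open>x' = p' / q'\<close> this says that the twisted curve
  \<open>y\<^sup>2 + y = b (x + 1 / x + T + 1 / T)\<close> has points \<open>P, P'\<close> with first coordinates
  \<open>x, x'\<close> and \<open>P' = P \<plusminus> Q\<close>, where \<open>Q = (T, 0)\<close>. The equation is quadratic in
  \<open>x'\<close>, so one rational neighbour of \<open>x\<close> yields the other one without any group law.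
\<close>
definition chain_rel :: "'a::field \<Rightarrow> 'a poly \<Rightarrow> 'a poly \<Rightarrow> 'a poly \<Rightarrow> 'a poly \<Rightarrow> bool" where
  "chain_rel b p q p' q' \<longleftrightarrow>
    [:b:] * (p\<^sup>2 * p'\<^sup>2 + T\<^sup>2 * q\<^sup>2 * p'\<^sup>2 + T\<^sup>2 * p\<^sup>2 * q'\<^sup>2 + q\<^sup>2 * q'\<^sup>2) + T * p * q * p' * q' = 0"

lemma chain_rel_commute: "chain_rel b p q p' q' \<longleftrightarrow> chain_rel b p' q' p q"
proof -
  have "T * p * q * p' * q' = T * p' * q' * p * q"
    by (simp only: ac_simps)
  moreover have "p\<^sup>2 * p'\<^sup>2 + T\<^sup>2 * q\<^sup>2 * p'\<^sup>2 + T\<^sup>2 * p\<^sup>2 * q'\<^sup>2 + q\<^sup>2 * q'\<^sup>2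
      = p'\<^sup>2 * p\<^sup>2 + T\<^sup>2 * q'\<^sup>2 * p\<^sup>2 + T\<^sup>2 * p'\<^sup>2 * q\<^sup>2 + q'\<^sup>2 * q\<^sup>2"
    by (simp only: ac_simps)
  ultimately show ?thesis
    unfolding chain_rel_def by (simp only:)
qed

lemma comaximal_nonzero: "comaximal p q \<Longrightarrow> p \<noteq> 0 \<or> q \<noteq> (0 :: 'a::comm_ring_1)"
  unfolding comaximal_def by auto

text \<open>The binary quadratic form with coefficients \<open>a\<close>, \<open>r\<close>,
  \<open>s\<close> vanishes at \<open>(p, q)\<close>, so the linear form \<open>q X - p Y\<close>
  splits off, because its coefficients are comaximal. The cofactor \<open>q' X - p' Y\<close>
  carries the second root.\<close>

lemma vieta_factors:
  fixes a r s p q :: "'a::idom"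
  assumes "comaximal p q" "a * p\<^sup>2 + r * p * q + s * q\<^sup>2 = 0"
  obtains p' q' where "a = q * q'" "r = - (p * q' + p' * q)" "s = p * p'"
proof -
  obtain u v where uv: "u * p + v * q = 1"
    using assms(1) unfolding comaximal_def by blast
  have "q dvd p\<^sup>2 * a"
  proof
    show "p\<^sup>2 * a = q * - (r * p + s * q)"
      using assms(2) by (simp add: algebra_simps power2_eq_square eq_neg_iff_add_eq_0)
  qed
  then have "q dvd a"
    using assms(1) comaximal_dvd_cancel comaximal_power comaximal_commute by metis
  then obtain q' where q': "a = q * q'" by (elim dvdE)
  have "p dvd q\<^sup>2 * s"
  proof
    show "q\<^sup>2 * s = p * - (r * q + a * p)"
      using assms(2) by (simp add: algebra_simps power2_eq_square eq_neg_iff_add_eq_0)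
  qed
  then have "p dvd s"
    using assms(1) comaximal_dvd_cancel comaximal_power by metis
  then obtain p' where p': "s = p * p'" by (elim dvdE)
  \<comment> \<open>The middle coefficient follows by cancelling \<open>p * q\<close>. If one of
    them is zero, the other is a unit, and the cofactors are chosen anew with its inverse.\<close>
  consider "p = 0" | "q = 0" | "p \<noteq> 0" "q \<noteq> 0" by blast
  then show ?thesis
  proof cases
    case 1
    then have vq: "v * q = 1" and s0: "s = 0"
      using uv assms(2) by auto
    show ?thesis
    proof (rule that)
      have "a = (v * q) * a" "r = (v * q) * r"
        by (simp_all add: vq)
      then show "a = q * (v * a)" "r = - (p * (v * a) + - (v * r) * q)"
        using 1 by (simp_all add: ac_simps)
      show "s = p * - (v * r)"
        using 1 s0 by simp
    qed
  next
    case 2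
    then have up: "u * p = 1" and a0: "a = 0"
      using uv assms(2) by auto
    show ?thesis
    proof (rule that)
      have "s = (u * p) * s" "r = (u * p) * r"
        by (simp_all add: up)
      then show "s = p * (u * s)" "r = - (p * - (u * r) + u * s * q)"
        using 2 by (simp_all add: ac_simps)
      show "a = q * - (u * r)"
        using 2 a0 by simp
    qed
  next
    case 3
    have "p * q * (r + (p * q' + p' * q)) = a * p\<^sup>2 + r * p * q + s * q\<^sup>2"
      unfolding p' q' by (simp add: algebra_simps power2_eq_square)
    then have "r + (p * q' + p' * q) = 0"
      using assms(2) 3 by simp
    then show ?thesis
      using that[OF q' _ p'] by (simp only: eq_neg_iff_add_eq_0)
  qed
qed

text \<open>Gauss's lemma at infinity. The coefficients of the three right-hand sides at the sum of
  the two heights come from a product of two nonzero linear forms, so one of them is nonzero. On the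
  left the terms with \<open>T\<^sup>2\<close> reach degree \<open>2 * ratio_height p q + 2\<close>,
  and nothing exceeds it.\<close>

lemma ratio_height_vieta:
  fixes p q :: "'a::field poly"
  assumes b: "b \<noteq> 0"
    and nz: "p \<noteq> 0 \<or> q \<noteq> 0" "p' \<noteq> 0 \<or> q' \<noteq> 0" "p'' \<noteq> 0 \<or> q'' \<noteq> 0"
    and a: "[:b:] * (p\<^sup>2 + T\<^sup>2 * q\<^sup>2) = q' * q''"
    and r: "T * p * q = - (p' * q'' + p'' * q')"
    and s: "[:b:] * (T\<^sup>2 * p\<^sup>2 + q\<^sup>2) = p' * p''"
  shows "ratio_height p' q' + ratio_height p'' q'' = 2 * ratio_height p q + 2"
proof -
  let ?d = "ratio_height p q" and ?d' = "ratio_height p' q'" and ?d'' = "ratio_height p'' q''"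
  have bd: "degree p \<le> ?d" "degree q \<le> ?d" "degree p' \<le> ?d'" "degree q' \<le> ?d'"
    "degree p'' \<le> ?d''" "degree q'' \<le> ?d''"
    by (auto intro: ratio_height_bounds)
  have sq: "degree (x\<^sup>2) \<le> 2 * ?d" "degree (T\<^sup>2 * x\<^sup>2) \<le> 2 * ?d + 2"
    "coeff (T\<^sup>2 * x\<^sup>2) (2 * ?d + 2) = (coeff x ?d)\<^sup>2"
    if "degree x \<le> ?d" for x :: "'a poly"
  proof -
    show 1: "degree (x\<^sup>2) \<le> 2 * ?d"
      using that by (simp add: power2_eq_square order_trans[OF degree_mult_le])
    have T2: "degree (T\<^sup>2 :: 'a poly) \<le> 2" "coeff (T\<^sup>2 :: 'a poly) 2 = 1"
      by (simp_all add: power2_eq_square numeral_2_eq_2)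
    show "degree (T\<^sup>2 * x\<^sup>2) \<le> 2 * ?d + 2"
      using degree_mult_le[of "T\<^sup>2" "x\<^sup>2"] T2(1) 1 by linarith
    show "coeff (T\<^sup>2 * x\<^sup>2) (2 * ?d + 2) = (coeff x ?d)\<^sup>2"
      using coeff_mult_bound[OF T2(1) 1] coeff_mult_bound[OF that that] T2(2)
      by (simp add: power2_eq_square add.commute mult_2)
  qed
  have sq0: "coeff (x\<^sup>2) (2 * ?d + 2) = 0" if "degree x \<le> ?d" for x :: "'a poly"
    using sq(1)[OF that] by (intro coeff_eq_0) linarith
  have dega: "degree (q' * q'') \<le> 2 * ?d + 2"
    unfolding a[symmetric] using sq(1)[OF bd(1)] sq(2)[OF bd(2)]
    by (intro order_trans[OF degree_mult_le]) (auto intro!: degree_add_le)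
  have degs: "degree (p' * p'') \<le> 2 * ?d + 2"
    unfolding s[symmetric] using sq(2)[OF bd(1)] sq(1)[OF bd(2)]
    by (intro order_trans[OF degree_mult_le]) (auto intro!: degree_add_le)
  have "degree (T * p * q) \<le> 1 + ?d + ?d"
    using degree_mult_le[of "T * p" q] degree_mult_le[of T p] bd by simp
  then have degr: "degree (p' * q'' + p'' * q') \<le> 2 * ?d + 2"
    unfolding r degree_minus by linarith
  have E: "coeff (q' * q'') (?d' + ?d'') = coeff q' ?d' * coeff q'' ?d''"
    "coeff (p' * p'') (?d' + ?d'') = coeff p' ?d' * coeff p'' ?d''"
    "coeff (p' * q'' + p'' * q') (?d' + ?d'')
      = coeff p' ?d' * coeff q'' ?d'' + coeff p'' ?d'' * coeff q' ?d'"
    using bd coeff_mult_bound[OF bd(5,4)] by (simp_all add: coeff_mult_bound add.commute)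
  have "coeff (q' * q'') (?d' + ?d'') \<noteq> 0 \<or> coeff (p' * p'') (?d' + ?d'') \<noteq> 0 \<or>
      coeff (p' * q'' + p'' * q') (?d' + ?d'') \<noteq> 0"
    using ratio_height_coeff[OF nz(2)] ratio_height_coeff[OF nz(3)] unfolding E by auto
  then have 1: "?d' + ?d'' \<le> 2 * ?d + 2"
    using dega degs degr le_degree le_trans by blast
  have "coeff (q' * q'') (2 * ?d + 2) = b * (coeff q ?d)\<^sup>2"
    "coeff (p' * p'') (2 * ?d + 2) = b * (coeff p ?d)\<^sup>2"
    unfolding a[symmetric] s[symmetric] using sq sq0 bd by simp_all
  then have "coeff (q' * q'') (2 * ?d + 2) \<noteq> 0 \<or> coeff (p' * p'') (2 * ?d + 2) \<noteq> 0"
    using ratio_height_coeff[OF nz(1)] b by auto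
  moreover have "degree (q' * q'') \<le> ?d' + ?d''" "degree (p' * p'') \<le> ?d' + ?d''"
    using bd by (meson add_mono degree_mult_le le_trans)+
  ultimately have "2 * ?d + 2 \<le> ?d' + ?d''"
    using le_degree le_trans by blast
  with 1 show ?thesis
    by simp
qed

text \<open>
  The elementary symmetric functions of the two neighbours of \<open>p / q\<close> are quotients of three
  polynomials without common divisor, so the second neighbour is again in lowest terms.
\<close>
lemma chain_step:
  fixes p q :: "'a::field poly"
  assumes b: "b \<noteq> 0" and cm: "comaximal p q" "comaximal p' q'"
    and rel: "chain_rel b p q p' q'"
  obtains p'' q'' where "comaximal p'' q''" "chain_rel b p q p'' q''"
    "ratio_height p' q' + ratio_height p'' q'' = 2 * ratio_height p q + 2"
proof -
  have "([:b:] * (p\<^sup>2 + T\<^sup>2 * q\<^sup>2)) * p'\<^sup>2 + (T * p * q) * p' * q' + ([:b:] * (T\<^sup>2 * p\<^sup>2 + q\<^sup>2)) * q'\<^sup>2 = 0"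
    using rel unfolding chain_rel_def by (simp only: algebra_simps)
  from vieta_factors[OF cm(2) this] obtain p'' q'' where
    a: "[:b:] * (p\<^sup>2 + T\<^sup>2 * q\<^sup>2) = q' * q''"
    and r: "T * p * q = - (p' * q'' + p'' * q')"
    and s: "[:b:] * (T\<^sup>2 * p\<^sup>2 + q\<^sup>2) = p' * p''"
    by metis
  have unit: "c dvd 1" if "c dvd p''" "c dvd q''" for c
  proof -
    have bc: "c dvd [:b:] * x \<Longrightarrow> c dvd x" for x
      using b by (simp add: dvd_smult_cancel)
    have 1: "c dvd p\<^sup>2 + T\<^sup>2 * q\<^sup>2" "c dvd T\<^sup>2 * p\<^sup>2 + q\<^sup>2"
      by (rule bc, simp add: a s that del: mult_pCons_left mult_pCons_right)+
    have "c dvd T * p * q"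
      unfolding r using that by simp
    then have 2: "c dvd T\<^sup>2 * (T\<^sup>2 * p\<^sup>2 * q\<^sup>2)"
      by (metis dvd_mult power_mult_distrib dvd_mult2 power2_eq_square)
    \<comment> \<open>The divisor \<open>c\<close> might share a factor with \<open>T\<close>, so
      \<open>T\<close> is eliminated by combining all three divisibilities.\<close>
    have "p\<^sup>2 * q\<^sup>2 = T\<^sup>2 * (T\<^sup>2 * p\<^sup>2 * q\<^sup>2) - p\<^sup>2 * (T\<^sup>2 * (p\<^sup>2 + T\<^sup>2 * q\<^sup>2) - (T\<^sup>2 * p\<^sup>2 + q\<^sup>2))"
      by (simp only: algebra_simps)
    then have 3: "c dvd p\<^sup>2 * q\<^sup>2"
      using 1 2 by (metis dvd_diff dvd_mult)
    have "p ^ 4 = p\<^sup>2 * (p\<^sup>2 + T\<^sup>2 * q\<^sup>2) - T\<^sup>2 * (p\<^sup>2 * q\<^sup>2)"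
      "q ^ 4 = q\<^sup>2 * (T\<^sup>2 * p\<^sup>2 + q\<^sup>2) - T\<^sup>2 * (p\<^sup>2 * q\<^sup>2)"
      by (simp_all only: algebra_simps power2_eq_square power4_eq_xxxx)
    then have "c dvd p ^ 4" "c dvd q ^ 4"
      using 1 3 by (metis dvd_diff dvd_mult)+
    with comaximal_power_power[OF cm(1)] show ?thesis
      by (rule comaximal_dvd_1)
  qed
  have nz: "p \<noteq> 0 \<or> q \<noteq> 0" "p' \<noteq> 0 \<or> q' \<noteq> 0"
    using cm by (auto dest: comaximal_nonzero)
  have nz'': "p'' \<noteq> 0 \<or> q'' \<noteq> 0"
    using unit[of 0] by auto
  show ?thesis
  proof (rule that)
    show "comaximal p'' q''"
      using nz'' unit by (rule comaximal_polyI)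
    have "[:b:] * (p\<^sup>2 * p''\<^sup>2 + T\<^sup>2 * q\<^sup>2 * p''\<^sup>2 + T\<^sup>2 * p\<^sup>2 * q''\<^sup>2 + q\<^sup>2 * q''\<^sup>2) + T * p * q * p'' * q''
      = ([:b:] * (p\<^sup>2 + T\<^sup>2 * q\<^sup>2)) * p''\<^sup>2 + (T * p * q) * p'' * q'' + ([:b:] * (T\<^sup>2 * p\<^sup>2 + q\<^sup>2)) * q''\<^sup>2"
      by (simp only: algebra_simps)
    also have "\<dots> = 0"
      unfolding a r s by (simp add: algebra_simps power2_eq_square)
    finally show "chain_rel b p q p'' q''"
      unfolding chain_rel_def .
  qed (rule ratio_height_vieta[OF b nz nz'' a r s])
qed

text \<open>By \<open>chain_step\<close> the heights along the chain have constant second difference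
  2, so they are a quadratic function of the index; \<open>c\<close> fits it to the first two
  heights. The induction carries two consecutive members.\<close>

lemma chain_heights:
  fixes p q p' q' :: "'a::field poly"
  assumes b: "b \<noteq> 0" and cm: "comaximal p q" "comaximal p' q'"
    and rel: "chain_rel b p q p' q'"
  defines "c \<equiv> int (ratio_height p' q') - int (ratio_height p q) - 1"
  shows "(int n)\<^sup>2 + c * int n + int (ratio_height p q) \<ge> 0"
proof -
  have "\<exists>u v u' v'. comaximal u v \<and> comaximal u' v' \<and> chain_rel b u v u' v' \<and>
      int (ratio_height u v) = (int n)\<^sup>2 + c * int n + int (ratio_height p q) \<and>
      int (ratio_height u' v') = (int (Suc n))\<^sup>2 + c * int (Suc n) + int (ratio_height p q)"
  proof (induction n)
    case 0
    show ?case
      using cm rel by (intro exI[of _ p] exI[of _ q] exI[of _ p'] exI[of _ q']) (auto simp: c_def)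
  next
    case (Suc n)
    then obtain u v u' v' where uv: "comaximal u v" "comaximal u' v'" "chain_rel b u' v' u v"
      and h: "int (ratio_height u v) = (int n)\<^sup>2 + c * int n + int (ratio_height p q)"
      "int (ratio_height u' v') = (int (Suc n))\<^sup>2 + c * int (Suc n) + int (ratio_height p q)"
      by (auto simp: chain_rel_commute)
    from chain_step[OF b uv(2,1,3)] obtain u'' v'' where uv'': "comaximal u'' v''"
      "chain_rel b u' v' u'' v''"
      and h'': "ratio_height u v + ratio_height u'' v'' = 2 * ratio_height u' v' + 2"
      by metis
    have "int (ratio_height u'' v'') = 2 * int (ratio_height u' v') + 2 - int (ratio_height u v)"
      using h'' by linarith
    also have "\<dots> = (int (Suc (Suc n)))\<^sup>2 + c * int (Suc (Suc n)) + int (ratio_height p q)"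
      unfolding h by (simp add: algebra_simps power2_eq_square)
    finally show ?case
      using uv(2) uv'' h(2) by blast
  qed
  then show ?thesis
    by (metis of_nat_0_le_iff)
qed

text \<open>Evaluate at an integer nearest to the vertex \<open>- c / 2\<close>. The extra 1 comes
  from odd \<open>c\<close>, where the vertex is a half-integer.\<close>

lemma quadratic_nonneg_on_int:
  fixes c h :: int
  assumes "\<And>n. n\<^sup>2 + c * n + h \<ge> 0"
  shows "c\<^sup>2 \<le> 4 * h + 1"
proof (cases "even c")
  case True
  then obtain d where "c = 2 * d" by (elim evenE)
  then show ?thesis
    using assms[of "- d"] by (simp add: power2_eq_square algebra_simps)
next
  case False
  then obtain d where "c = 2 * d + 1" by (elim oddE)
  then show ?thesis
    using assms[of "- d"] by (simp add: power2_eq_square algebra_simps)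
qed

lemma chain_discriminant:
  fixes p q p' q' :: "'a::field poly"
  assumes b: "b \<noteq> 0" and cm: "comaximal p q" "comaximal p' q'"
    and rel: "chain_rel b p q p' q'"
  defines "c \<equiv> int (ratio_height p' q') - int (ratio_height p q) - 1"
  shows "c\<^sup>2 \<le> 4 * int (ratio_height p q) + 1"
proof (rule quadratic_nonneg_on_int)
  fix n :: int
  show "n\<^sup>2 + c * n + int (ratio_height p q) \<ge> 0"
  proof (cases "n \<ge> 0")
    case True
    then show ?thesis
      using chain_heights[OF b cm rel, of "nat n"] by (simp add: c_def)
  next
    case False
    \<comment> \<open>Negative indices are reached by running the chain backwards from its second
      member, which replaces the index \<open>n\<close> by \<open>1 - n\<close>.\<close>
    have "chain_rel b p' q' p q"
      using rel by (simp add: chain_rel_commute)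
    with chain_heights[OF b cm(2,1) this, of "nat (1 - n)"] False show ?thesis
      by (simp add: c_def algebra_simps power2_eq_square)
  qed
qed

section \<open>The Weil bound for Kloosterman sums\<close>


lemma add_power_two_power:
  fixes x y :: "'a::comm_ring_1"
  assumes "(2 :: 'a) = 0"
  shows "(x + y) ^ (2 ^ n) = x ^ (2 ^ n) + y ^ (2 ^ n)"
proof (induction n)
  case (Suc n)
  have "(x + y) ^ (2 ^ Suc n) = ((x + y) ^ (2 ^ n))\<^sup>2"
    by (simp add: power_mult mult.commute[of 2])
  also have "\<dots> = (x ^ (2 ^ n))\<^sup>2 + (y ^ (2 ^ n))\<^sup>2"
    by (simp add: Suc power2_sum assms)
  finally show ?case
    by (simp add: power_mult mult.commute[of 2])
qed simp

lemma sum_power2_char_2: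
  fixes f :: "'b \<Rightarrow> 'a::comm_ring_1"
  assumes "(2 :: 'a) = 0"
  shows "(\<Sum>i\<in>I. f i)\<^sup>2 = (\<Sum>i\<in>I. (f i)\<^sup>2)"
  by (induction I rule: infinite_finite_induct) (auto simp: power2_sum assms)

lemma prod_linear_factors_dvd:
  fixes p :: "'a::idom poly"
  assumes "finite S" "\<And>a. a \<in> S \<Longrightarrow> poly p a = 0"
  shows "(\<Prod>a\<in>S. [:- a, 1:]) dvd p"
  using assms
proof (induction S arbitrary: p rule: finite_induct)
  case (insert a S)
  obtain k where k: "p = [:- a, 1:] * k"
    using insert.prems[of a] by (auto simp: poly_eq_0_iff_dvd)
  have "poly k s = 0" if "s \<in> S" for s
    using insert.prems[of s] insert.hyps(2) that unfolding k by auto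
  then have "(\<Prod>a\<in>S. [:- a, 1:]) dvd k"
    by (rule insert.IH)
  then show ?case
    unfolding k prod.insert[OF insert.hyps] by (rule mult_dvd_mono[OF dvd_refl])
qed simp

lemma prod_linear_factors:
  fixes S :: "'a::idom set"
  assumes "finite S"
  shows "(\<Prod>a\<in>S. [:- a, 1:]) \<noteq> 0" "degree (\<Prod>a\<in>S. [:- a, 1:]) = card S"
    "lead_coeff (\<Prod>a\<in>S. [:- a, 1:]) = 1"
proof -
  show nz: "(\<Prod>a\<in>S. [:- a, 1:]) \<noteq> 0" for S :: "'a set"
    by (induction S rule: infinite_finite_induct) (auto simp del: mult_pCons_left)
  show "degree (\<Prod>a\<in>S. [:- a, 1:]) = card S"
    using assms
  proof (induction S rule: finite_induct)
    case (insert a S)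
    then show ?case
      using nz[of S] by (simp add: degree_mult_eq del: mult_pCons_left)
  qed simp
  show "lead_coeff (\<Prod>a\<in>S. [:- a, 1:]) = 1"
    by (simp add: lead_coeff_prod)
qed

lemma coeff_T_power: "coeff (T ^ k) n = (if k = n then 1 else 0)"
  by (metis coeff_monom monom_altdef smult_1_left)

lemma degree_T_power: "degree (T ^ k) = k"
  by (simp add: degree_power_eq)

text \<open>Instantiated with \<open>t = T\<close>, \<open>z\<close> the power of \<open>T\<close>
  to half the field order, and \<open>g * v\<close> the trace numerator. Squaring the quadratic
  equation replaces \<open>z\<close> by \<open>Z\<close>. Multiplication by \<open>g ^ 4\<close>
  makes \<open>?E\<close> an expression in \<open>g * v\<close> and \<open>g * l\<close>, which
  collapses to a multiple of 2.\<close>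

lemma chain_start_identity:
  fixes t :: "'a::idom"
  assumes two: "(2 :: 'a) = 0" and "t \<noteq> 0" "g \<noteq> 0" "Z = z\<^sup>2"
    and L: "t * (g * l) = Z + t"
    and key: "t * ((g * v)\<^sup>2 + z * (g * v)) = c * ((Z * t + 1) * (Z + t))"
  shows "c * (Z\<^sup>2 * (v\<^sup>2)\<^sup>2 + t\<^sup>2 * 1\<^sup>2 * (v\<^sup>2)\<^sup>2 + t\<^sup>2 * Z\<^sup>2 * (c * t * l\<^sup>2)\<^sup>2 + 1\<^sup>2 * (c * t * l\<^sup>2)\<^sup>2)
    + t * Z * 1 * v\<^sup>2 * (c * t * l\<^sup>2) = 0" (is "?E = 0")
proof -
  have sq: "(x + y)\<^sup>2 = x\<^sup>2 + y\<^sup>2" for x y :: 'a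
    using add_power_two_power[OF two, of x y 1] by simp
  have "t * ((g * v)\<^sup>2 + z * (g * v)) = t * (c * (Z * t + 1) * (g * l))"
    unfolding key L[symmetric] by (simp add: algebra_simps)
  then have "(g * v)\<^sup>2 + z * (g * v) = c * (Z * t + 1) * (g * l)"
    using \<open>t \<noteq> 0\<close> by simp
  then have "((g * v)\<^sup>2 + z * (g * v))\<^sup>2 = (c * (Z * t + 1) * (g * l))\<^sup>2"
    by (rule arg_cong)
  then have e2: "((g * v)\<^sup>2)\<^sup>2 + Z * (g * v)\<^sup>2 = c\<^sup>2 * (Z\<^sup>2 * t\<^sup>2 + 1) * (g * l)\<^sup>2"
    by (simp add: sq power_mult_distrib \<open>Z = z\<^sup>2\<close>)
  have e1: "Z\<^sup>2 + t\<^sup>2 = t\<^sup>2 * (g * l)\<^sup>2"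
    using arg_cong[OF L, of "\<lambda>x. x\<^sup>2"] by (simp add: sq power_mult_distrib)
  have "g ^ 4 * ?E = c * ((Z\<^sup>2 + t\<^sup>2) * ((g * v)\<^sup>2)\<^sup>2
      + t\<^sup>2 * (g * l)\<^sup>2 * (Z * (g * v)\<^sup>2 + c\<^sup>2 * (Z\<^sup>2 * t\<^sup>2 + 1) * (g * l)\<^sup>2))"
    by (simp add: algebra_simps power_mult_distrib power2_eq_square power4_eq_xxxx)
  also have "\<dots> = c * (t\<^sup>2 * (g * l)\<^sup>2) * ((((g * v)\<^sup>2)\<^sup>2 + Z * (g * v)\<^sup>2) + c\<^sup>2 * (Z\<^sup>2 * t\<^sup>2 + 1) * (g * l)\<^sup>2)"
    unfolding e1 by (simp only: distrib_left mult.assoc add.assoc)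
  also have "\<dots> = c * (t\<^sup>2 * (g * l)\<^sup>2) * (2 * (c\<^sup>2 * (Z\<^sup>2 * t\<^sup>2 + 1) * (g * l)\<^sup>2))"
    unfolding e2 mult_2 ..
  also have "\<dots> = 0"
    by (simp add: two)
  finally show ?thesis
    using \<open>g \<noteq> 0\<close> by simp
qed

text \<open>
  \<open>T\<^bsup>q/2\<^esup> Tr (b (T + 1 / T))\<close> with \<open>q = 2\<^sup>m\<close>. The Frobenius point has first coordinate
  \<open>T\<^sup>q\<close>, and \<open>Tr (b (T + 1 / T))\<close> is its second coordinate because the trace sum telescopes.
\<close>
definition trace_numerator :: "nat \<Rightarrow> 'a::field \<Rightarrow> 'a poly" where
  "trace_numerator m b =
    (\<Sum>i<m. [:b ^ (2 ^ i):] * (T ^ (2 ^ (m - 1) + 2 ^ i) + T ^ (2 ^ (m - 1) - 2 ^ i)))"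

lemma two_eq_0_poly: "(2 :: 'a::comm_ring_1) = 0 \<Longrightarrow> (2 :: 'a poly) = 0"
  by (simp add: numeral_poly)

section \<open>The Frobenius point and the count of trace zeros\<close>

context
  fixes m :: nat and b :: "'a::{field,finite}"
  assumes m: "m > 0" and card: "CARD('a) = 2 ^ m" and b: "b \<noteq> 0"
begin

abbreviation (input) "W \<equiv> trace_numerator m b"

lemma field_two_eq_0: "(2 :: 'a) = 0" and poly_two_eq_0: "(2 :: 'a poly) = 0"
  using two_eq_0_field[OF card] two_eq_0_poly by auto

lemma two_times_half_power: "2 * 2 ^ (m - 1) = (2 ^ m :: nat)"
  using m by (cases m) auto

text \<open>This is the curve equation for the Frobenius point, cleared of denominators. Squaring
  shifts the trace sum by one index, so adding the unshifted sum leaves only the two end terms, and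
  \<open>b ^ (2 ^ m) = b\<close>.\<close>

lemma trace_numerator_quadratic:
  "W\<^sup>2 + T ^ (2 ^ (m - 1)) * W = [:b:] * (T ^ (2 * 2 ^ m) + 1 + T ^ (2 ^ m + 1) + T ^ (2 ^ m - 1))"
proof -
  \<comment> \<open>\<open>g i\<close> is \<open>T ^ (2 ^ m)\<close> times the \<open>i\<close>-th
    Frobenius conjugate of \<open>b (T + 1 / T)\<close>.\<close>
  define g where "g i = [:b ^ (2 ^ i):] * (T ^ (2 ^ m + 2 ^ i) + T ^ (2 ^ m - 2 ^ i))" for i
  have le: "(2::nat) ^ i \<le> 2 ^ (m - 1)" if "i < m" for i
    using that by (intro power_increasing) auto
  have "W\<^sup>2 = (\<Sum>i<m. g (Suc i))"
    unfolding trace_numerator_def sum_power2_char_2[OF poly_two_eq_0]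
  proof (rule sum.cong[OF refl])
    fix i assume "i \<in> {..<m}"
    have "([:b ^ (2 ^ i):] * (T ^ (2 ^ (m - 1) + 2 ^ i) + T ^ (2 ^ (m - 1) - 2 ^ i)))\<^sup>2
        = [:b ^ (2 ^ i):]\<^sup>2 * (T ^ (2 * (2 ^ (m - 1) + 2 ^ i)) + T ^ (2 * (2 ^ (m - 1) - 2 ^ i)))"
      by (simp only: power_mult_distrib power2_sum poly_two_eq_0 mult_zero_left add_0_right
          mult.commute[of 2 "_ + _"] mult.commute[of 2 "_ - _"] power_mult)
    also have "[:b ^ (2 ^ i):]\<^sup>2 = [:b ^ (2 ^ Suc i):]"
      by (simp add: power2_eq_square power_add[symmetric] mult_2)
    finally show "([:b ^ (2 ^ i):] * (T ^ (2 ^ (m - 1) + 2 ^ i) + T ^ (2 ^ (m - 1) - 2 ^ i)))\<^sup>2 = g (Suc i)"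
      unfolding g_def by (simp only: diff_mult_distrib2 distrib_left two_times_half_power power_Suc)
  qed
  moreover have "T ^ (2 ^ (m - 1)) * W = (\<Sum>i<m. g i)"
    unfolding trace_numerator_def sum_distrib_left
  proof (rule sum.cong[OF refl])
    fix i assume "i \<in> {..<m}"
    then have "2 ^ (m - 1) + (2 ^ (m - 1) - 2 ^ i) = (2 ^ m - 2 ^ i :: nat)"
      "2 ^ (m - 1) + (2 ^ (m - 1) + 2 ^ i) = (2 ^ m + 2 ^ i :: nat)"
      using le[of i] two_times_half_power by auto
    then show "T ^ (2 ^ (m - 1)) * ([:b ^ (2 ^ i):] * (T ^ (2 ^ (m - 1) + 2 ^ i) + T ^ (2 ^ (m - 1) - 2 ^ i))) = g i"
      unfolding g_def mult.left_commute[of _ "[:b ^ (2 ^ i):]"] distrib_left power_add[symmetric]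
      by (simp only:)
  qed
  moreover have "(\<Sum>i<m. g (Suc i)) = (\<Sum>i<m. g i) + g m - g 0"
    using sum.lessThan_Suc_shift[of g m] by simp
  ultimately have "W\<^sup>2 + T ^ (2 ^ (m - 1)) * W = 2 * (\<Sum>i<m. g i) + g m + g 0 - 2 * g 0"
    by (simp only: mult_2) simp
  also have "\<dots> = g m + g 0"
    by (simp add: poly_two_eq_0)
  also have "\<dots> = [:b:] * (T ^ (2 * 2 ^ m) + 1 + T ^ (2 ^ m + 1) + T ^ (2 ^ m - 1))"
    unfolding g_def using power_card_field[of b]
    by (simp only: card diff_self_eq_0 power_0 power_one_right mult_2 add.assoc distrib_left)
  finally show ?thesis .
qed

text \<open>Hence the nonzero roots of \<open>W\<close> are exactly the trace zeros to be
  counted.\<close>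

lemma poly_trace_numerator:
  assumes "x \<noteq> 0"
  shows "poly W x = x ^ (2 ^ (m - 1)) * abs_trace m (b * (x + inverse x))"
  unfolding trace_numerator_def abs_trace_def poly_sum sum_distrib_left
proof (rule sum.cong[OF refl])
  fix i assume "i \<in> {..<m}"
  then have "(2::nat) ^ i \<le> 2 ^ (m - 1)"
    by (intro power_increasing) auto
  then have "x ^ (2 ^ (m - 1) - 2 ^ i) = x ^ (2 ^ (m - 1)) * inverse x ^ (2 ^ i)"
    using assms by (simp add: power_diff power_inverse field_simps)
  then show "poly ([:b ^ 2 ^ i:] * (T ^ (2 ^ (m - 1) + 2 ^ i) + T ^ (2 ^ (m - 1) - 2 ^ i))) x
      = x ^ 2 ^ (m - 1) * (b * (x + inverse x)) ^ 2 ^ i"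
    by (simp add: power_mult_distrib add_power_two_power[OF field_two_eq_0] power_add algebra_simps)
qed

text \<open>Keeps the factor \<open>T\<close> of the denominator of the second chain member from
  cancelling.\<close>

lemma poly_trace_numerator_0: "poly W 0 \<noteq> 0"
proof -
  have "2 ^ m - 1 \<noteq> (0::nat)"
    using one_less_power[of "2::nat" m] m by linarith
  then have "poly (W\<^sup>2 + T ^ (2 ^ (m - 1)) * W) 0 = b"
    unfolding trace_numerator_quadratic by (simp add: zero_power)
  then show ?thesis
    using b by (auto simp: zero_power)
qed

text \<open>In \<open>trace_numerator_quadratic\<close> only \<open>W\<^sup>2\<close> contributes to
  degree \<open>2 * 2 ^ m\<close> on the left, so the coefficient of \<open>W\<close> at
  \<open>2 ^ m\<close> has square \<open>b\<close>.\<close>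

lemma degree_trace_numerator: "degree W = 2 ^ m"
proof -
  have le: "degree W \<le> 2 ^ m"
    unfolding trace_numerator_def
  proof (rule degree_sum_le)
    fix i assume "i \<in> {..<m}"
    then have "(2::nat) ^ i \<le> 2 ^ (m - 1)"
      by (intro power_increasing) auto
    then have "2 ^ (m - 1) + 2 ^ i \<le> (2 ^ m :: nat)" "2 ^ (m - 1) - 2 ^ i \<le> (2 ^ m :: nat)"
      using two_times_half_power by linarith+
    then have "degree (T ^ (2 ^ (m - 1) + 2 ^ i) + T ^ (2 ^ (m - 1) - 2 ^ i) :: 'a poly) \<le> 2 ^ m"
      by (intro degree_add_le) (simp_all add: degree_T_power)
    then show "degree ([:b ^ 2 ^ i:] * (T ^ (2 ^ (m - 1) + 2 ^ i) + T ^ (2 ^ (m - 1) - 2 ^ i))) \<le> 2 ^ m"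
      using degree_smult_le le_trans by fastforce
  qed simp
  have "degree (T ^ (2 ^ (m - 1)) * W) \<le> 2 ^ (m - 1) + 2 ^ m"
    using degree_mult_le[of "T ^ (2 ^ (m - 1))" W] le by (simp add: degree_T_power)
  moreover have "2 ^ (m - 1) + 2 ^ m < (2 ^ m + 2 ^ m :: nat)"
    using two_times_half_power by (metis add_less_cancel_right mult_2 less_add_same_cancel1 zero_less_power pos2)
  ultimately have "coeff (T ^ (2 ^ (m - 1)) * W) (2 ^ m + 2 ^ m) = 0"
    by (intro coeff_eq_0) linarith
  then have "coeff (W\<^sup>2 + T ^ (2 ^ (m - 1)) * W) (2 ^ m + 2 ^ m) = (coeff W (2 ^ m))\<^sup>2"
    using coeff_mult_bound[OF le le] by (simp add: power2_eq_square)
  moreover have "coeff ([:b:] * (T ^ (2 * 2 ^ m) + 1 + T ^ (2 ^ m + 1) + T ^ (2 ^ m - 1))) (2 ^ m + 2 ^ m) = b"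
  proof -
    have "2 ^ m + 1 \<noteq> (2 ^ m + 2 ^ m :: nat)" "2 ^ m - 1 \<noteq> (2 ^ m + 2 ^ m :: nat)"
      using one_less_power[of "2::nat" m] m by linarith+
    then show ?thesis
      by (simp add: coeff_T_power coeff_1 del: power_Suc)
  qed
  ultimately have "(coeff W (2 ^ m))\<^sup>2 = b"
    unfolding trace_numerator_quadratic by metis
  then have "coeff W (2 ^ m) \<noteq> 0"
    using b by auto
  then show ?thesis
    using le le_degree by (metis antisym)
qed

text \<open>Every field element is a root of the right-hand side, and both sides are monic of degree
  \<open>2 ^ m\<close>.\<close>

lemma prod_linear_factors_UNIV: "(\<Prod>a\<in>UNIV. [:- a, 1:]) = T ^ (2 ^ m) + (T :: 'a poly)"
proof -
  let ?M = "T ^ (2 ^ m) + (T :: 'a poly)"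
  have "poly ?M a = 0" for a
    using power_card_field[of a] by (simp add: card mult_2[symmetric] field_two_eq_0)
  then have "(\<Prod>a\<in>UNIV. [:- a, 1:]) dvd ?M"
    by (intro prod_linear_factors_dvd) auto
  then obtain k where k: "?M = (\<Prod>a\<in>UNIV. [:- a, 1:]) * k"
    by (elim dvdE)
  have "1 < (2 ^ m :: nat)"
    using m by (intro one_less_power) auto
  then have deg: "degree ?M = 2 ^ m"
    by (subst degree_add_eq_left) (simp_all add: degree_T_power)
  then have "coeff ?M (degree ?M) = 1"
    using \<open>1 < 2 ^ m\<close> coeff_T_power[of 1 "2 ^ m", where 'a='a] by (simp add: coeff_T_power)
  then have lc: "lead_coeff k = 1"
    unfolding k lead_coeff_mult prod_linear_factors(3)[OF finite] by simp
  then have "degree ?M = CARD('a) + degree k"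
    unfolding k using prod_linear_factors[of "UNIV :: 'a set"]
    by (subst degree_mult_eq) auto
  then have "degree k = 0"
    using deg card by simp
  then have "k = 1"
    using lc by (metis degree_eq_zeroE coeff_pCons_0 one_pCons)
  with k show ?thesis
    by simp
qed

text \<open>
  The chain starts at \<open>T\<^sup>q\<close> and \<open>W\<^sup>2 / (b T (T\<^bsup>q-1\<^esup> + 1)\<^sup>2)\<close>; in the latter exactly the factors
  \<open>(T - a)\<^sup>2\<close> for the nonzero roots \<open>a\<close> of \<open>W\<close> cancel, so its height counts those roots.
\<close>
lemma trace_zeros_bound:
  fixes N :: nat
  defines "N \<equiv> card {x. x \<noteq> 0 \<and> abs_trace m (b * (x + inverse x)) = 0}"
  shows "(2 ^ m - 1 - 2 * int N)\<^sup>2 \<le> 4 * 2 ^ m + 1"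
proof -
  define S where "S = {x. x \<noteq> 0 \<and> abs_trace m (b * (x + inverse x)) = 0}"
  define R where "R = UNIV - {0} - S"
  define g where "g = (\<Prod>a\<in>S. [:- a, 1:])"
  define l where "l = (\<Prod>a\<in>R. [:- a, 1:])"
  have S: "S = {x. x \<noteq> 0 \<and> poly W x = 0}"
    unfolding S_def using poly_trace_numerator by auto
  have "card (UNIV - {0 :: 'a}) = 2 ^ m - 1"
    using card by (simp add: card_Diff_singleton)
  moreover have SR: "S \<union> R = UNIV - {0}" "S \<inter> R = {}"
    unfolding R_def S by auto
  then have "card (UNIV - {0 :: 'a}) = card S + card R"
    by (metis card_Un_disjoint finite)
  ultimately have cards: "card R + card S = 2 ^ m - 1"
    by simp
  have "g dvd W"
    unfolding g_def S by (intro prod_linear_factors_dvd) auto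
  then obtain v where v: "W = g * v"
    by (elim dvdE)
  have g0: "g \<noteq> 0" and l0: "l \<noteq> 0" and dg: "degree g = card S" and dl: "degree l = card R"
    unfolding g_def l_def by (simp_all only: prod_linear_factors[OF finite] not_False_eq_True)
  \<comment> \<open>\<open>v\<close> may still vanish on \<open>S\<close>, but not at 0 or on
    \<open>R\<close>, where the remaining denominator has its zeros.\<close>
  have v0: "poly v x \<noteq> 0" if "x \<notin> S" for x
    using that poly_trace_numerator_0 unfolding S v by (cases "x = 0") auto
  have "v \<noteq> 0"
    using v0[of 0] by (auto simp: S)
  then have dv: "degree v + card S = 2 ^ m"
    using degree_trace_numerator degree_mult_eq[OF g0] unfolding v dg by simp
  have "T * (g * l) = [:- 0, 1:] * (\<Prod>a\<in>UNIV - {0}. [:- a, 1:])"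
    unfolding g_def l_def SR(1)[symmetric] using SR(2)
    by (subst prod.union_disjoint) auto
  also have "\<dots> = (\<Prod>a\<in>UNIV. [:- a, 1:])"
    by (rule prod.remove[symmetric]) auto
  finally have L: "T * (g * l) = T ^ (2 ^ m) + T"
    unfolding prod_linear_factors_UNIV .
  \<comment> \<open>What remains of \<open>b T (g l)\<^sup>2\<close> after cancelling
    \<open>g\<^sup>2\<close>.\<close>
  let ?v = "[:b:] * T * l\<^sup>2"
  have cm: "comaximal (v\<^sup>2) ?v"
  proof (rule comaximal_mult[OF comaximal_mult])
    show "comaximal (v\<^sup>2) [:b:]"
      unfolding comaximal_def using b
      by (intro exI[of _ 0] exI[of _ "[:1 / b:]"]) (simp add: one_pCons)
    show "comaximal (v\<^sup>2) T"
      using comaximal_linear_poly[of "v\<^sup>2" 0] v0[of 0] by (simp add: S)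
    have "comaximal v l"
      unfolding l_def using v0 by (intro comaximal_prod comaximal_linear_poly) (auto simp: R_def)
    then show "comaximal (v\<^sup>2) (l\<^sup>2)"
      by (rule comaximal_power_power)
  qed
  have "T * ((g * v)\<^sup>2 + T ^ (2 ^ (m - 1)) * (g * v))
      = [:b:] * (T * (T ^ (2 * 2 ^ m) + 1 + T ^ (2 ^ m + 1) + T ^ (2 ^ m - 1)))"
    using trace_numerator_quadratic unfolding v by (simp only: mult.left_commute)
  also have "(T :: 'a poly) * (T ^ (2 * 2 ^ m) + 1 + T ^ (2 ^ m + 1) + T ^ (2 ^ m - 1))
      = (T ^ (2 ^ m) * T + 1) * (T ^ (2 ^ m) + T)"
  proof -
    have e1: "T * T ^ (2 ^ m - 1) = (T :: 'a poly) ^ (2 ^ m)"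
      by (metis power_eq_if zero_neq_numeral power_not_zero)
    have e2: "(T :: 'a poly) ^ (2 * 2 ^ m) = T ^ (2 ^ m) * T ^ (2 ^ m)"
      "(T :: 'a poly) ^ (2 ^ m + 1) = T ^ (2 ^ m) * T"
      by (simp_all only: mult_2 power_add power_one_right)
    show ?thesis
      by (simp only: distrib_left distrib_right e1 e2 mult_1_left mult_1_right) (simp only: ac_simps)
  qed
  finally have key: "T * ((g * v)\<^sup>2 + T ^ (2 ^ (m - 1)) * (g * v))
      = [:b:] * ((T ^ (2 ^ m) * T + 1) * (T ^ (2 ^ m) + T))" .
  have "T ^ (2 ^ m) = ((T :: 'a poly) ^ (2 ^ (m - 1)))\<^sup>2"
    by (simp only: power_mult[symmetric] mult.commute[of _ 2] two_times_half_power)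
  from chain_start_identity[OF poly_two_eq_0 _ g0 this L key]
  have rel: "chain_rel b (T ^ (2 ^ m)) 1 (v\<^sup>2) ?v"
    unfolding chain_rel_def by simp
  have "degree (v\<^sup>2) = 2 * degree v"
    by (simp add: power2_eq_square degree_mult_eq \<open>v \<noteq> 0\<close>)
  moreover have "degree ?v = 1 + 2 * card R"
    using l0 b by (simp add: degree_mult_eq power2_eq_square dl)
  moreover have "(2 ^ m :: nat) > 0" by simp
  \<comment> \<open>The numerator wins by exactly one degree: \<open>2 * 2 ^ m - 2 * card S\<close>
    against \<open>2 * 2 ^ m - 1 - 2 * card S\<close>.\<close>
  ultimately have "ratio_height (v\<^sup>2) ?v = 2 * degree v"
    unfolding ratio_height_def using dv cards by linarith
  moreover have "ratio_height (T ^ (2 ^ m)) (1 :: 'a poly) = 2 ^ m"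
    by (simp add: ratio_height_def degree_T_power)
  ultimately have "(2 * int (degree v) - 2 ^ m - 1)\<^sup>2 \<le> 4 * 2 ^ m + 1"
    using chain_discriminant[OF b comaximal_1 cm rel] by simp
  moreover have "int (degree v) = 2 ^ m - int N"
    using dv unfolding N_def S_def[symmetric] by (metis add_diff_cancel_right' of_nat_add of_nat_numeral of_nat_power)
  ultimately show ?thesis
    by (simp add: algebra_simps)
qed

end

text \<open>With \<open>b\<close> the square root of \<open>a\<close> given by Frobenius, the
  substitution \<open>x = y / b\<close> turns \<open>a x + 1 / x\<close> into
  \<open>b (y + 1 / y)\<close>. The sum is then twice the number of trace zeros minus
  \<open>2 ^ m - 1\<close>.\<close>

theorem kloosterman_weil_bound:
  fixes a :: "'a::{field,finite}"
  assumes m: "m > 0" and card: "CARD('a) = 2 ^ m" and a: "a \<noteq> 0"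
  shows "(kloosterman m a)\<^sup>2 \<le> 4 * 2 ^ m + 1"
proof -
  define b where "b = a ^ (2 ^ (m - 1))"
  have "b\<^sup>2 = a ^ (2 ^ m)"
    unfolding b_def power_mult[symmetric] using m by (cases m) (auto simp: mult.commute)
  then have b2: "b\<^sup>2 = a"
    using power_card_field[of a] card by simp
  then have b: "b \<noteq> 0"
    using a by auto
  define S where "S = {x. x \<noteq> 0 \<and> abs_trace m (b * (x + inverse x)) = 0}"
  have "kloosterman m a = (\<Sum>y\<in>UNIV - {0}. trace_sign m (a * (y / b) + inverse (y / b)))"
    unfolding kloosterman_def
    using b by (intro sum.reindex_bij_witness[of _ "\<lambda>y. y / b" "\<lambda>x. x * b"]) auto
  also have "\<dots> = (\<Sum>y\<in>UNIV - {0}. trace_sign m (b * (y + inverse y)))"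
  proof (rule sum.cong[OF refl])
    fix y
    have "a * (y / b) + inverse (y / b) = b * (y + inverse y)"
      unfolding b2[symmetric] using b by (simp add: power2_eq_square field_simps)
    then show "trace_sign m (a * (y / b) + inverse (y / b)) = trace_sign m (b * (y + inverse y))"
      by simp
  qed
  also have "\<dots> = (\<Sum>y\<in>UNIV - {0}. 2 * (if y \<in> S then 1 else 0) - 1)"
    by (intro sum.cong) (auto simp: S_def trace_sign_def)
  also have "\<dots> = 2 * int (card S) - int (card (UNIV - {0 :: 'a}))"
  proof -
    have "(UNIV - {0}) \<inter> S = S" unfolding S_def by auto
    then show ?thesis
      by (simp add: sum_subtractf sum_distrib_left[symmetric] sum.If_cases Int_def[symmetric] del: card_Diff_insert)
  qed
  also have "\<dots> = - (2 ^ m - 1 - 2 * int (card S))"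
    using card by (simp add: card_Diff_singleton of_nat_diff)
  finally have "kloosterman m a = - (2 ^ m - 1 - 2 * int (card S))" .
  then show ?thesis
    using trace_zeros_bound[OF m card b] unfolding S_def[symmetric] by (simp only: power2_minus)
qed

section \<open>Spectrum of the Cayley graph\<close>


lemma abs_trace_add:
  fixes x y :: "'a::{field,finite}"
  assumes "(2 :: 'a) = 0"
  shows "abs_trace m (x + y) = abs_trace m x + abs_trace m y"
  by (simp add: abs_trace_def add_power_two_power[OF assms] sum.distrib)

lemma trace_sign_0 [simp]: "trace_sign m 0 = 1"
  by (simp add: trace_sign_def abs_trace_def power_0_left)

context
  fixes m :: nat
  assumes m: "m > 0" and card: "CARD('a::{field,finite}) = 2 ^ m"
begin

lemma char_2: "(2 :: 'a) = 0"
  using card by (rule two_eq_0_field)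

lemma add_self: "x + x = (0 :: 'a)"
  using char_2 by (metis mult_2 mult_zero_left)

lemma minus_char_2: "x - y = x + (y :: 'a)"
  using add_self[of y] by (metis add_diff_cancel diff_add_cancel add.assoc add_0_right)

lemma trace_sign_add: "trace_sign m (x + y) = trace_sign m x * trace_sign m (y :: 'a)"
  using abs_trace_in_prime_field[OF card, of x] abs_trace_in_prime_field[OF card, of y]
  by (auto simp: trace_sign_def abs_trace_add[OF char_2] add_self[of 1, simplified])

text \<open>The trace is a nonzero polynomial of degree at most \<open>2 ^ (m - 1)\<close>, too
  small to vanish on the whole field.\<close>

lemma trace_sign_nontrivial: "\<exists>c :: 'a. trace_sign m c = - 1"
proof (rule ccontr)
  assume "\<not> (\<exists>c :: 'a. trace_sign m c = - 1)"
  then have tr: "abs_trace m (c :: 'a) = 0" for c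
    by (auto simp: trace_sign_def split: if_splits)
  define p :: "'a poly" where "p = (\<Sum>i<m. monom 1 (2 ^ i))"
  have "poly p c = abs_trace m c" for c
    unfolding p_def abs_trace_def poly_sum poly_monom by simp
  then have roots: "{c. poly p c = 0} = UNIV"
    using tr by auto
  have "coeff p (2 ^ (m - 1)) = (\<Sum>i<m. if i = m - 1 then 1 else 0)"
    unfolding p_def coeff_sum coeff_monom by (intro sum.cong) auto
  then have "p \<noteq> 0"
    using m by auto
  then have "CARD('a) \<le> degree p"
    using card_poly_roots_bound[of p] roots by simp
  moreover have "degree p \<le> 2 ^ (m - 1)"
    unfolding p_def
    by (intro degree_sum_le) (auto intro!: order_trans[OF degree_monom_le] power_increasing)
  moreover have "2 ^ (m - 1) < (2 ^ m :: nat)"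
    using m by (intro power_strict_increasing) auto
  ultimately show False
    using card by simp
qed

text \<open>For \<open>a \<noteq> 0\<close> a translation by \<open>c / a\<close> with
  \<open>trace_sign m c = - 1\<close> negates the sum.\<close>

lemma sum_trace_sign: "(\<Sum>z\<in>UNIV. trace_sign m (a * z)) = (if a = (0 :: 'a) then 2 ^ m else 0)"
proof (cases "a = 0")
  case False
  obtain c :: 'a where c: "trace_sign m c = - 1"
    using trace_sign_nontrivial by blast
  have "(\<Sum>z\<in>UNIV. trace_sign m (a * z)) = (\<Sum>z\<in>UNIV. trace_sign m (a * (z + c / a)))"
    by (intro sum.reindex_bij_witness[of _ "\<lambda>z. z + c / a" "\<lambda>z. z - c / a"]) auto
  also have "\<dots> = - (\<Sum>z\<in>UNIV. trace_sign m (a * z))"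
    using False c by (simp add: distrib_left trace_sign_add sum_negf)
  finally show ?thesis
    using False by simp
qed (use card in simp)

definition trace_set :: "'a set" where
  "trace_set = {z. z \<noteq> 0 \<and> abs_trace m z = 1 \<and> abs_trace m (inverse z) = 1}"

text \<open>The eigenvalue of the Cayley graph that belongs to the character sending
  \<open>z\<close> to \<open>trace_sign m (a * z)\<close>.\<close>

definition char_sum :: "'a \<Rightarrow> int" where
  "char_sum a = (\<Sum>d\<in>trace_set. trace_sign m (a * d))"

text \<open>Expanding the indicator gives two plain character sums and two Kloosterman sums. The
  omission of \<open>z = 0\<close> costs each plain sum 1, and these corrections cancel.\<close>

lemma char_sum_kloosterman:
  "4 * char_sum a = (if a = 0 then 2 ^ m else 0) - (if a = 1 then 2 ^ m else 0)
    - kloosterman m a + kloosterman m (a + 1)"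
proof -
  let ?s = "trace_sign m :: 'a \<Rightarrow> int"
  have nz: "(\<Sum>z\<in>UNIV - {0}. ?s (a * z)) = (if a = 0 then 2 ^ m else 0) - 1" for a
    using sum_trace_sign[of a] by (simp add: sum_diff1)
  have "a + 1 = 0 \<longleftrightarrow> a = 1"
    using minus_char_2[of a 1] by (metis eq_iff_diff_eq_0)
  have ind: "(if z \<in> trace_set then 4 else 0) = (1 - ?s z) * (1 - ?s (inverse z))" if "z \<noteq> 0" for z
    using that abs_trace_in_prime_field[OF card, of z] abs_trace_in_prime_field[OF card, of "inverse z"]
    by (auto simp: trace_set_def trace_sign_def)
  have "4 * char_sum a = (\<Sum>z\<in>UNIV - {0}. (if z \<in> trace_set then 4 else 0) * ?s (a * z))"
    unfolding char_sum_def sum_distrib_left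
    by (intro sum.mono_neutral_cong_left) (auto simp: trace_set_def)
  also have "\<dots> = (\<Sum>z\<in>UNIV - {0}. ?s (a * z) - ?s ((a + 1) * z) - ?s (a * z + inverse z)
      + ?s ((a + 1) * z + inverse z))"
    by (rule sum.cong[OF refl])
      (simp add: ind trace_sign_add distrib_left distrib_right algebra_simps)
  also have "\<dots> = (if a = 0 then 2 ^ m else 0) - (if a = 1 then 2 ^ m else 0)
      - kloosterman m a + kloosterman m (a + 1)"
    unfolding sum.distrib sum_subtractf nz kloosterman_def using \<open>a + 1 = 0 \<longleftrightarrow> a = 1\<close> by simp
  finally show ?thesis .
qed

lemma kloosterman_0: "kloosterman m (0 :: 'a) = - 1"
proof -
  have "kloosterman m (0 :: 'a) = (\<Sum>z\<in>UNIV - {0}. trace_sign m (1 * z :: 'a))"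
    unfolding kloosterman_def
    by (intro sum.reindex_bij_witness[of _ inverse inverse]) auto
  also have "\<dots> = - 1"
    using sum_trace_sign[of 1] by (simp add: sum_diff1)
  finally show ?thesis .
qed

lemma char_sum_0: "char_sum 0 = int (card trace_set)"
  by (simp add: char_sum_def)

lemma char_sum_values:
  shows "4 * char_sum 0 = 2 ^ m + 1 + kloosterman m (1 :: 'a)"
    and "char_sum 1 = - char_sum 0"
    and "a \<noteq> 0 \<Longrightarrow> a \<noteq> 1 \<Longrightarrow> 4 * char_sum a = - kloosterman m a + kloosterman m (a + 1)"
  using char_sum_kloosterman[of 0] char_sum_kloosterman[of 1] char_sum_kloosterman[of a]
    kloosterman_0 add_self[of 1] by simp_all

section \<open>Fourier transform and eigenvalues\<close>

lemma adjacency_matrix_cayley: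
  "(adjacency_matrix (cayley_graph trace_set) *v x) $ u = (\<Sum>d\<in>trace_set. x $ (u - d))"
proof -
  have "(adjacency_matrix (cayley_graph trace_set) *v x) $ u
      = (\<Sum>w\<in>UNIV. (if u - w \<in> trace_set then 1 else 0) * x $ w)"
    by (simp add: matrix_vector_mult_def adjacency_matrix_def cayley_graph_def)
  also have "\<dots> = (\<Sum>w | u - w \<in> trace_set. x $ w)"
    by (intro sum.mono_neutral_cong_right) auto
  also have "\<dots> = (\<Sum>d\<in>trace_set. x $ (u - d))"
    by (intro sum.reindex_bij_witness[of _ "\<lambda>d. u - d" "\<lambda>w. u - w"]) auto
  finally show ?thesis .
qed

definition fourier :: "(real, 'a) vec \<Rightarrow> 'a \<Rightarrow> real" where
  "fourier x a = (\<Sum>u\<in>UNIV. trace_sign m (a * u) * x $ u)"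

text \<open>Orthogonality of characters. Since \<open>v + u = v - u\<close>, the same kernel serves
  in both directions.\<close>

lemma fourier_inversion: "(\<Sum>a\<in>UNIV. trace_sign m (a * v) * fourier x a) = 2 ^ m * x $ v"
proof -
  have "(\<Sum>a\<in>UNIV. trace_sign m (a * v) * fourier x a)
      = (\<Sum>u\<in>UNIV. \<Sum>a\<in>UNIV. trace_sign m (a * v) * (trace_sign m (a * u) * x $ u))"
    unfolding fourier_def sum_distrib_left by (rule sum.swap)
  also have "\<dots> = (\<Sum>u\<in>UNIV. real_of_int (\<Sum>a\<in>UNIV. trace_sign m ((v - u) * a)) * x $ u)"
    unfolding minus_char_2 distrib_right trace_sign_add of_int_sum of_int_mult sum_distrib_right
    by (simp only: mult_ac)
  also have "\<dots> = (\<Sum>u\<in>UNIV. if u = v then 2 ^ m * x $ u else 0)"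
    unfolding sum_trace_sign by (intro sum.cong) auto
  finally show ?thesis
    by simp
qed

text \<open>The adjacency operator sums the translates by \<open>trace_set\<close>, and a
  translation by \<open>d\<close> multiplies the transform by
  \<open>trace_sign m (a * d)\<close>.\<close>

lemma fourier_adjacency:
  "fourier (adjacency_matrix (cayley_graph trace_set) *v x) a = char_sum a * fourier x a"
proof -
  have "fourier (adjacency_matrix (cayley_graph trace_set) *v x) a
      = (\<Sum>d\<in>trace_set. \<Sum>u\<in>UNIV. trace_sign m (a * u) * x $ (u - d))"
    unfolding fourier_def adjacency_matrix_cayley sum_distrib_left by (rule sum.swap)
  also have "\<dots> = (\<Sum>d\<in>trace_set. \<Sum>u\<in>UNIV. trace_sign m (a * (u + d)) * x $ u)"
  proof (rule sum.cong[OF refl])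
    fix d
    show "(\<Sum>u\<in>UNIV. trace_sign m (a * u) * x $ (u - d)) = (\<Sum>u\<in>UNIV. trace_sign m (a * (u + d)) * x $ u)"
      by (rule sum.reindex_bij_witness[of _ "\<lambda>u. u + d" "\<lambda>u. u - d"]) auto
  qed
  also have "\<dots> = (\<Sum>d\<in>trace_set. trace_sign m (a * d) * fourier x a)"
    unfolding fourier_def sum_distrib_left
    by (simp add: distrib_left trace_sign_add mult_ac)
  also have "\<dots> = char_sum a * fourier x a"
    unfolding char_sum_def by (simp add: sum_distrib_right)
  finally show ?thesis .
qed

lemma eigenvector_fourier:
  assumes "adjacency_matrix (cayley_graph trace_set) *v x = l *s x" "fourier x a \<noteq> 0"
  shows "l = char_sum a"
proof -
  have "l * fourier x a = fourier (l *s x) a"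
    unfolding fourier_def by (simp add: sum_distrib_left mult_ac)
  then show ?thesis
    using fourier_adjacency[of x a] assms by simp
qed

text \<open>By inversion an eigenvector has a nonzero Fourier coefficient, which determines its
  eigenvalue. Conversely each character is an eigenvector.\<close>

lemma graph_eigenvalues_cayley:
  "graph_eigenvalues (cayley_graph trace_set) = range (\<lambda>a. real_of_int (char_sum a))"
proof (intro equalityI subsetI)
  fix l assume "l \<in> graph_eigenvalues (cayley_graph trace_set)"
  then obtain x where x: "x \<noteq> 0" "adjacency_matrix (cayley_graph trace_set) *v x = l *s x"
    unfolding graph_eigenvalues_def matrix_eigenvalue_def by blast
  have "\<exists>a. fourier x a \<noteq> 0"
  proof (rule ccontr)
    assume "\<not> (\<exists>a. fourier x a \<noteq> 0)"
    then have "x $ v = 0" for v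
      using fourier_inversion[of v x] by simp
    with x(1) show False
      by (simp add: vec_eq_iff)
  qed
  then show "l \<in> range (\<lambda>a. real_of_int (char_sum a))"
    using eigenvector_fourier[OF x(2)] by blast
next
  fix l assume "l \<in> range (\<lambda>a. real_of_int (char_sum a))"
  then obtain a where l: "l = char_sum a"
    by blast
  define x :: "(real, 'a) vec" where "x = (\<chi> u. trace_sign m (a * u))"
  have "x $ 0 \<noteq> 0 $ 0"
    by (simp add: x_def)
  then have "x \<noteq> 0"
    by metis
  moreover have "adjacency_matrix (cayley_graph trace_set) *v x = l *s x"
    unfolding vec_eq_iff adjacency_matrix_cayley l char_sum_def
    by (simp add: x_def minus_char_2 distrib_left trace_sign_add sum_distrib_left mult_ac)
  ultimately show "l \<in> graph_eigenvalues (cayley_graph trace_set)"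
    unfolding graph_eigenvalues_def matrix_eigenvalue_def by blast
qed

section \<open>Graph properties and the Ramanujan bound\<close>

lemma pair_graph_cayley: "pair_graph (cayley_graph trace_set)"
proof unfold_locales
  show "symmetric (with_proj (cayley_graph trace_set))"
    by (auto simp: symmetric_def sym_def cayley_graph_def minus_char_2 add.commute)
qed (auto simp: cayley_graph_def trace_set_def)

text \<open>The parts are the two trace classes: elements of \<open>trace_set\<close> have trace 1,
  so every edge changes the trace.\<close>

lemma bipartite_cayley: "bipartite_graph (cayley_graph trace_set)"
  unfolding bipartite_graph_def
proof (intro conjI exI)
  show "{x. abs_trace m x = 0} \<union> {x. abs_trace m x = 1} = pverts (cayley_graph trace_set)"
    using abs_trace_in_prime_field[OF card] by (auto simp: cayley_graph_def)
  have "abs_trace m x \<noteq> abs_trace m y" if "x - y \<in> trace_set" for x y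
    using that unfolding trace_set_def minus_char_2
    by (auto simp: abs_trace_add[OF char_2] add_self)
  moreover have "abs_trace m x = 0 \<or> abs_trace m x = 1" for x :: 'a
    using abs_trace_in_prime_field[OF card, of x] by blast
  ultimately show "\<forall>(u, v)\<in>parcs (cayley_graph trace_set).
      (u \<in> {x. abs_trace m x = 0} \<and> v \<in> {x. abs_trace m x = 1}) \<or>
      (u \<in> {x. abs_trace m x = 1} \<and> v \<in> {x. abs_trace m x = 0})"
    unfolding cayley_graph_def by (simp add: split_def) metis
qed (use pair_graph_cayley in auto)

lemma regular_cayley: "regular_graph (card trace_set) (cayley_graph trace_set)"
  unfolding regular_graph_def
proof (intro conjI ballI)
  fix v :: 'a
  have "bij_betw (\<lambda>d. (v, v - d)) trace_set (out_arcs (with_proj (cayley_graph trace_set)) v)"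
    by (intro bij_betwI[where g = "\<lambda>e. v - snd e"]) (auto simp: out_arcs_def cayley_graph_def)
  then show "out_degree (with_proj (cayley_graph trace_set)) v = card trace_set"
    unfolding out_degree_def by (metis bij_betw_same_card)
qed (rule pair_graph_cayley)

text \<open>
  The indicator of a component is an eigenvector for the valency; if only the trivial character
  has that eigenvalue, the indicator is constant.
\<close>
lemma connected_cayley:
  assumes less: "\<And>a. a \<noteq> 0 \<Longrightarrow> char_sum a < char_sum 0"
  shows "Digraph_Component.connected (with_proj (cayley_graph trace_set))"
proof -
  \<comment> \<open>Connectedness is defined as strong connectedness of the symmetric
    closure.\<close>
  let ?G = "with_proj (mk_symmetric (with_proj (cayley_graph trace_set)))"
  interpret G: pair_wf_digraph "mk_symmetric (with_proj (cayley_graph trace_set))"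
    by unfold_locales (auto simp: parcs_mk_symmetric cayley_graph_def)
  have arcs: "(v, v - d) \<in> arcs_ends ?G" "(v - d, v) \<in> arcs_ends ?G" if "d \<in> trace_set" for v d
    unfolding with_proj_simps parcs_mk_symmetric using that
    by (rule_tac UN_I[where a = "(v, v - d)"], simp add: cayley_graph_def, simp)+
  have "u \<rightarrow>\<^sup>*\<^bsub>?G\<^esub> v" for u v
  proof -
    define x :: "(real, 'a) vec" where "x = (\<chi> w. if u \<rightarrow>\<^sup>*\<^bsub>?G\<^esub> w then 1 else 0)"
    have "u \<rightarrow>\<^sup>*\<^bsub>?G\<^esub> (w - d) \<longleftrightarrow> u \<rightarrow>\<^sup>*\<^bsub>?G\<^esub> w" if "d \<in> trace_set" for w d
      using arcs[OF that, of w] G.reachable_adj_trans by auto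
    then have "x $ (w - d) = x $ w" if "d \<in> trace_set" for w d
      using that by (simp add: x_def)
    then have ev: "adjacency_matrix (cayley_graph trace_set) *v x = real_of_int (char_sum 0) *s x"
      by (simp add: vec_eq_iff adjacency_matrix_cayley char_sum_0)
    have "fourier x a = 0" if "a \<noteq> 0" for a
      using eigenvector_fourier[OF ev, of a] less[OF that] by fastforce
    then have "(\<Sum>a\<in>UNIV. trace_sign m (a * w) * fourier x a) = fourier x 0" for w
      by (subst sum.remove[of _ 0]) auto
    then have "x $ v = x $ u"
      using fourier_inversion[of v x] fourier_inversion[of u x] by simp
    moreover have "u \<rightarrow>\<^sup>*\<^bsub>?G\<^esub> u"
      by (rule G.reachable_refl) (simp add: cayley_graph_def)
    then have "x $ u = 1"
      by (simp add: x_def)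
    ultimately show ?thesis
      by (simp add: x_def split: if_splits)
  qed
  then show ?thesis
    unfolding connected_def strongly_connected_def by (auto simp: cayley_graph_def)
qed

text \<open>Both \<open>a\<close> and \<open>a + 1\<close> are nonzero, so the Weil bound applies to
  each Kloosterman sum; the square of their difference is at most twice the sum of their
  squares.\<close>

lemma char_sum_bound:
  assumes "a \<noteq> 0" "a \<noteq> 1"
  shows "4 * (char_sum a)\<^sup>2 \<le> 4 * 2 ^ m + 1"
proof -
  have "a + 1 \<noteq> 0"
    using assms(2) minus_char_2[of a 1] by (metis eq_iff_diff_eq_0)
  have "(4 * char_sum a)\<^sup>2 \<le> 2 * (kloosterman m a)\<^sup>2 + 2 * (kloosterman m (a + 1))\<^sup>2"
    unfolding char_sum_values(3)[OF assms]
    using zero_le_power2[of "kloosterman m a + kloosterman m (a + 1)"]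
    by (simp add: power2_eq_square algebra_simps)
  also have "\<dots> \<le> 4 * (4 * 2 ^ m + 1)"
    using kloosterman_weil_bound[OF m card assms(1)]
      kloosterman_weil_bound[OF m card \<open>a + 1 \<noteq> 0\<close>] by (simp add: algebra_simps)
  finally show ?thesis
    by (simp add: power2_eq_square)
qed

lemma char_sum_less:
  assumes "kloosterman m (1 :: 'a) > 3" "a \<noteq> 0"
  shows "char_sum a < char_sum 0"
proof (cases "a = 1")
  case True
  have "4 * char_sum 0 > 0"
    unfolding char_sum_values(1) using assms(1) zero_less_power[of "2 :: int" m] by linarith
  then show ?thesis
    unfolding True char_sum_values(2) by simp
next
  case False
  show ?thesis
  proof (rule ccontr)
    assume "\<not> char_sum a < char_sum 0"
    \<comment> \<open>Integrality turns \<open>kloosterman m 1 > 3\<close> into at least 4. The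
      bound on \<open>char_sum a\<close> then contradicts the positivity of
      \<open>(2 ^ m - 3)\<^sup>2 + 12\<close>.\<close>
    then have "2 ^ m + 5 \<le> 4 * char_sum a"
      using char_sum_values(1) assms(1) by linarith
    then have "(2 ^ m + 5)\<^sup>2 \<le> (4 * char_sum a)\<^sup>2"
      by (intro power_mono) auto
    also have "\<dots> \<le> 4 * (4 * 2 ^ m + 1)"
      using char_sum_bound[OF assms(2) False] by (simp add: power2_eq_square)
    finally have "(2 ^ m - 3)\<^sup>2 + 12 \<le> (0 :: int)"
      by (simp add: power2_eq_square algebra_simps)
    then show False
      using zero_le_power2[of "2 ^ m - 3 :: int"] by linarith
  qed
qed

lemma ramanujan_cayley:
  assumes "kloosterman m (1 :: 'a) > 3"
  shows "ramanujan_graph (cayley_graph trace_set)"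
  unfolding ramanujan_graph_def
proof (intro conjI exI ballI impI)
  show "pverts (cayley_graph trace_set) = UNIV"
    by (simp add: cayley_graph_def)
  show "Digraph_Component.connected (with_proj (cayley_graph trace_set))"
    using char_sum_less[OF assms] by (rule connected_cayley)
  show "regular_graph (card trace_set) (cayley_graph trace_set)"
    by (rule regular_cayley)
  fix l
  assume "l \<in> graph_eigenvalues (cayley_graph trace_set)" and l: "\<bar>l\<bar> \<noteq> real (card trace_set)"
  then obtain a where a: "l = char_sum a"
    unfolding graph_eigenvalues_cayley by blast
  \<comment> \<open>The characters 0 and 1 give plus and minus the valency, which \<open>l\<close>
    avoids.\<close>
  have "a \<noteq> 0" "a \<noteq> 1"
    using l char_sum_values(2) unfolding a by (auto simp: char_sum_0)
  \<comment> \<open>The right-hand side is \<open>4 * 2 ^ m + 4 * kloosterman m 1 - 12\<close>,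
    which is at least \<open>4 * 2 ^ m + 4\<close>.\<close>
  from char_sum_bound[OF this] have "4 * (char_sum a)\<^sup>2 \<le> 16 * (char_sum 0 - 1)"
    using char_sum_values(1) assms by (simp add: algebra_simps)
  then have "(char_sum a)\<^sup>2 \<le> 4 * (int (card trace_set) - 1)"
    unfolding char_sum_0 by simp
  then have "real_of_int ((char_sum a)\<^sup>2) \<le> real_of_int (4 * (int (card trace_set) - 1))"
    by (simp only: of_int_le_iff)
  then have "l \<le> sqrt (4 * (real (card trace_set) - 1))"
    unfolding a by (intro real_le_rsqrt) simp
  then show "l \<le> 2 * sqrt (real (card trace_set) - 1)"
    by (simp only: real_sqrt_mult real_sqrt_four)
qed

end

theorem theorem4p4:
  fixes m :: nat and D :: "'a::{field,finite} set"
  assumes "m > 0"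
    and "CARD('a) = 2 ^ m"
    and "D = {z. z \<noteq> 0 \<and> abs_trace m z = 1 \<and> abs_trace m (inverse z) = 1}"
  shows "bipartite_graph (cayley_graph D) \<and>
    (\<exists>k. regular_graph k (cayley_graph D) \<and>
       real k = (2 ^ m + 1 + real_of_int (kloosterman m (1 :: 'a))) / 4 \<and>
       graph_eigenvalues (cayley_graph D) =
         {real k, - real k} \<union>
         {real_of_int (- kloosterman m a + kloosterman m (a + 1)) / 4 | a :: 'a. a \<noteq> 0 \<and> a \<noteq> 1}) \<and>
    (kloosterman m (1 :: 'a) > 3 \<longrightarrow> ramanujan_graph (cayley_graph D))"
proof -
  note mc = assms(1,2)
  have D: "D = trace_set m"
    unfolding trace_set_def[OF mc] assms(3) ..
  let ?c = "char_sum m :: 'a \<Rightarrow> int"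
  let ?k = "card (trace_set m :: 'a set)"
  have "real_of_int (4 * ?c 0) = real_of_int (2 ^ m + 1 + kloosterman m (1 :: 'a))"
    unfolding char_sum_values(1)[OF mc] ..
  then have k: "real ?k = (2 ^ m + 1 + real_of_int (kloosterman m (1 :: 'a))) / 4"
    by (simp add: char_sum_0[OF mc])
  have c: "real_of_int (?c a) = real_of_int (- kloosterman m a + kloosterman m (a + 1)) / 4"
    if "a \<noteq> 0" "a \<noteq> 1" for a
    unfolding char_sum_values(3)[OF mc that, symmetric] by simp
  have "range (\<lambda>a. real_of_int (?c a)) = (\<lambda>a. real_of_int (?c a)) ` ({0, 1} \<union> {a. a \<noteq> 0 \<and> a \<noteq> 1})"
    by (rule arg_cong[where f = "image _"]) auto
  also have "\<dots> = {real ?k, - real ?k} \<union> (\<lambda>a. real_of_int (?c a)) ` {a. a \<noteq> 0 \<and> a \<noteq> 1}"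
    by (simp add: char_sum_values(2)[OF mc] char_sum_0[OF mc])
  also have "(\<lambda>a. real_of_int (?c a)) ` {a. a \<noteq> 0 \<and> a \<noteq> 1} =
      {real_of_int (- kloosterman m a + kloosterman m (a + 1)) / 4 | a :: 'a. a \<noteq> 0 \<and> a \<noteq> 1}"
    unfolding setcompr_eq_image by (rule image_cong[OF refl]) (use c in blast)
  finally show ?thesis
    unfolding D using bipartite_cayley[OF mc] regular_cayley[OF mc] ramanujan_cayley[OF mc]
      graph_eigenvalues_cayley[OF mc] k by auto
qed

end
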